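(* Let $n,n'$ be positive integers and $F$ be a finite field with characteristic coprime to both $n$ and $n'$. Let $C_{g,g'}$ be the double cyclic code generated by $\big(g(X),g'(X)\big)$, where $g(X)=\sum_{j=0}^{n-1}g_jX^j$ and $g'(X)=\sum_{j'=0}^{n'-1}g'_{j'}X^{j'}$ are polynomials over $F$. Let $m=\operatorname{lcm}(n,n')$ be the least common multiple of $n$ and $n'$, let $\ell=\gcd(n,n')$, $$d=\deg\frac{\gcd\big(g(X),\,X^n-1\big)\cdot\gcd\big(g'(X),\,X^{n'}-1\big)\cdot(X^\ell-1)}{\gcd\big(g(X)g'(X),\,X^\ell-1\big)}$$ and $r=n+n'-d$. Then $\dim C_{g,g'}=r$, and the first $r$ rows of the double circulant matrix $M(g,g')_{m\times(n+n')}$ associated with $g(X)$ and $g'(X)$ form a generator matrix of $C_{g,g'}$.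
   Context: The double cyclic code generated by $(g(X),g'(X))$ is the $F[X]$-submodule of $F[X]/\langle X^n-1\rangle\times F[X]/\langle X^{n'}-1\rangle$ given by $$C_{g,g'}=\big\{\big(f(X)g(X)\bmod (X^n-1),\; f(X)g'(X)\bmod (X^{n'}-1)\big)\;\big|\; f(X)\in F[X]\big\}.$$ An element $\big(a(X),a'(X)\big)$ with $a(X)=\sum_{j=0}^{n-1}a_jX^j$, $a'(X)=\sum_{j=0}^{n'-1}a'_jX^j$ is identified with the word $(a_0,\dots,a_{n-1},a'_0,\dots,a'_{n'-1})\in F^{n+n'}$, so $C_{g,g'}$ is viewed as a linear subspace of $F^{n+n'}$. A generator matrix of a linear code (subspace of $F^N$) is a matrix whose rows form a basis of the code. For a polynomial $g(X)=\sum_{j=0}^{n-1}g_jX^j$ of degree less than $n$, the generalized circulant matrix $M(g)_{m\times n}$ is the $m\times n$ matrix over $F$ whose $(i,j)$ entry ($0\le i<m$, $0\le j<n$) is $g_{(j-i)\bmod n}$; i.e. each row is the circular right shift of the previous one, the first row being $(g_0,\dots,g_{n-1})$. The double circulant matrix associated with $g(X)$ (with $\deg g<n$) and $g'(X)$ (with $\deg g'<n'$) is the side-by-side concatenation $M(g,g')_{m\times(n+n')}=\big(M(g)_{m\times n}\,\big|\,M(g')_{m\times n'}\big)$. The $\gcd$ of polynomials is the greatest common divisor in $F[X]$ (with $\gcd(0,f)=f$). *)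

theory Defs
  imports "Jordan_Normal_Form.VS_Connect" "HOL-Computational_Algebra.Polynomial"
begin

(* The library provides gcd on polynomials only over coefficient classes that carry a chosen
   gcd and normalisation (such as field_gcd). To allow every field, the gcd in F[X] is defined
   by its universal property, normalised to be monic (or 0, when both arguments are 0). *)
definition is_poly_gcd :: "'a::field poly \<Rightarrow> 'a poly \<Rightarrow> 'a poly \<Rightarrow> bool" where
  "is_poly_gcd p q h \<longleftrightarrow> h dvd p \<and> h dvd q \<and> (\<forall>k. k dvd p \<and> k dvd q \<longrightarrow> k dvd h)
     \<and> (h = 0 \<or> lead_coeff h = 1)"

definition poly_gcd :: "'a::field poly \<Rightarrow> 'a poly \<Rightarrow> 'a poly" where
  "poly_gcd p q = (THE h. is_poly_gcd p q h)"

lemma is_poly_gcd_unique: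
  assumes "is_poly_gcd p q h" and "is_poly_gcd p q h'"
  shows "h = h'"
proof -
  have "h dvd h'" "h' dvd h"
    using assms by (auto simp: is_poly_gcd_def)
  moreover have lc: "h = 0 \<or> lead_coeff h = 1" "h' = 0 \<or> lead_coeff h' = 1"
    using assms by (auto simp: is_poly_gcd_def)
  ultimately obtain u where u: "h' = h * u"
    by (auto elim: dvdE)
  show ?thesis
  proof (cases "h' = 0")
    case True
    then show ?thesis using \<open>h' dvd h\<close> by simp
  next
    case False
    then have nz: "h \<noteq> 0" "u \<noteq> 0" using u by auto
    have "degree h' \<le> degree h" using \<open>h' dvd h\<close> nz by (intro dvd_imp_degree_le) auto
    then have "degree u = 0" using u nz by (simp add: degree_mult_eq)
    then obtain c where c: "u = [:c:]" by (rule degree_eq_zeroE)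
    have "lead_coeff h' = lead_coeff h * lead_coeff u" using u by (simp add: lead_coeff_mult)
    then have "c = 1" using lc False nz c by simp
    then show ?thesis using u c by simp
  qed
qed

lemma is_poly_gcd_exists: "\<exists>h. is_poly_gcd p q h"
proof (induction "if q = 0 then 0 else Suc (degree q)" arbitrary: p q rule: less_induct)
  case less
  show ?case
  proof (cases "q = 0")
    case True
    show ?thesis
    proof (cases "p = 0")
      case p: True
      then show ?thesis using True by (auto simp: is_poly_gcd_def)
    next
      case False
      have "is_poly_gcd p q (Polynomial.smult (inverse (lead_coeff p)) p)"
        using True False by (auto simp: is_poly_gcd_def smult_dvd_iff dvd_smult_iff)
      then show ?thesis by blast
    qed
  next
    case False
    have "(if p mod q = 0 then 0 else Suc (degree (p mod q))) < Suc (degree q)"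
      using degree_mod_less[OF False, of p] by auto
    then obtain h where "is_poly_gcd q (p mod q) h"
      using less[of "p mod q" q] False by auto
    moreover have "k dvd q \<and> k dvd p mod q \<longleftrightarrow> k dvd p \<and> k dvd q" for k
      by (metis dvd_mod_iff)
    ultimately have "is_poly_gcd p q h"
      unfolding is_poly_gcd_def by metis
    then show ?thesis by blast
  qed
qed

lemma is_poly_gcd_poly_gcd: "is_poly_gcd p q (poly_gcd p q)"
  unfolding poly_gcd_def
  using is_poly_gcd_exists is_poly_gcd_unique by (metis theI')

definition poly_word :: "nat \<Rightarrow> 'a::field poly \<Rightarrow> 'a vec" where
  "poly_word n a = vec n (coeff a)"

definition double_cyclic_code :: "nat \<Rightarrow> nat \<Rightarrow> 'a::field poly \<Rightarrow> 'a poly \<Rightarrow> 'a vec set" where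
  "double_cyclic_code n n' g g' =
     {poly_word n (f * g mod (monom 1 n - 1)) @\<^sub>v poly_word n' (f * g' mod (monom 1 n' - 1)) | f. True}"

definition circulant_mat :: "nat \<Rightarrow> nat \<Rightarrow> 'a::field poly \<Rightarrow> 'a mat" where
  "circulant_mat m n g = mat m n (\<lambda>(i, j). coeff g (nat ((int j - int i) mod int n)))"

(* Side-by-side concatenation: the two lower blocks have no rows. *)
definition double_circulant_mat :: "nat \<Rightarrow> nat \<Rightarrow> nat \<Rightarrow> 'a::field poly \<Rightarrow> 'a poly \<Rightarrow> 'a mat" where
  "double_circulant_mat m n n' g g' =
     four_block_mat (circulant_mat m n g) (circulant_mat m n' g') (0\<^sub>m 0 n) (0\<^sub>m 0 n')"

definition first_rows :: "nat \<Rightarrow> 'a mat \<Rightarrow> 'a mat" where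
  "first_rows r A = mat_of_rows (dim_col A) (take r (rows A))"

abbreviation code_space :: "nat \<Rightarrow> 'a::field vec set \<Rightarrow> ('a, 'a vec) module" where
  "code_space N C \<equiv> (module_vec TYPE('a) N)\<lparr>carrier := C\<rparr>"

abbreviation code_dim :: "nat \<Rightarrow> 'a::field vec set \<Rightarrow> nat" where
  "code_dim N C \<equiv> vectorspace.dim class_ring (code_space N C)"

(* The library's notion of basis concerns sets of vectors; distinctness makes the rows,
   as a family, a basis. *)
definition generator_matrix :: "nat \<Rightarrow> 'a::field vec set \<Rightarrow> 'a mat \<Rightarrow> bool" where
  "generator_matrix N C G \<longleftrightarrow>
     VectorSpace.subspace class_ring C (module_vec TYPE('a) N) \<and>
     dim_col G = N \<and> distinct (rows G) \<and>
     vectorspace.basis class_ring (code_space N C) (set (rows G))"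

end

theory Submission
  imports Defs
begin

text \<open>
  The code is the range of the \<open>F\<close>-linear map \<open>\<phi>\<close> that sends \<open>f\<close> to the word of
  \<open>(f g mod X\<^sup>n - 1, f g' mod X^n' - 1)\<close>. Its kernel is an ideal \<open>(L)\<close> of \<open>F[X]\<close>, so the code is
  isomorphic to \<open>F[X]/(L)\<close>: it has dimension \<open>deg L\<close>, and the images of \<open>X\<^sup>i\<close> for \<open>i < deg L\<close> form a
  basis (\<open>basis_of_cyclic_module\<close>). Multiplication by \<open>X\<close> is a circular shift in both halves, so the
  image of \<open>X\<^sup>i\<close> is row \<open>i\<close> of the double circulant matrix
  (\<open>row_double_circulant_mat\<close>). There are enough rows, because \<open>L\<close> divides \<open>X\<^sup>m - 1\<close>.

  What remains is \<open>deg L = n + n' - d\<close> (\<open>annihilator_polynomial\<close>). The first half of \<open>\<phi> f\<close> vanishes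
  iff \<open>h1 = (X\<^sup>n - 1) / gcd g (X\<^sup>n - 1)\<close> divides \<open>f\<close>, the second half iff the analogous \<open>h2\<close> does;
  hence \<open>L\<close> is the least common multiple of \<open>h1\<close> and \<open>h2\<close>, and
  \<open>deg L = deg h1 + deg h2 - deg (gcd h1 h2)\<close>. Since the characteristic is coprime to \<open>n\<close> and \<open>n'\<close>,
  the polynomials \<open>X\<^sup>n - 1\<close> and \<open>X^n' - 1\<close> are squarefree. So \<open>gcd h1 h2\<close> is the product of the
  irreducible common factors of the two, that is of the factors of \<open>X\<^sup>l - 1\<close>, that divide neither
  \<open>g\<close> nor \<open>g'\<close>. Up to a unit, this is \<open>(X\<^sup>l - 1) / gcd (g g') (X\<^sup>l - 1)\<close>
  (\<open>degree_gcd_cofactors\<close>), and adding up degrees gives the formula.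
\<close>

section \<open>Bezout identities and gcds of polynomials\<close>

text \<open>Coprimality in Bezout form: multiplying the identity by \<open>x\<close> rewrites \<open>x\<close> as a
combination of \<open>p * x\<close> and \<open>q * x\<close>, which is how divisibilities get cancelled below.\<close>

definition comaximal :: "'a::comm_ring_1 \<Rightarrow> 'a \<Rightarrow> bool" where
  "comaximal p q \<longleftrightarrow> (\<exists>s t. s * p + t * q = 1)"

lemma comaximal_sym: "comaximal p q \<Longrightarrow> comaximal q p"
  unfolding comaximal_def by (metis add.commute)

lemma comaximal_dvd_mult:
  assumes "comaximal p q" "p dvd q * x"
  shows "p dvd x"
proof -
  obtain s t where "s * p + t * q = 1" using assms(1) by (auto simp: comaximal_def)
  then have "x = s * p * x + t * (q * x)" by (metis mult.assoc mult_1 distrib_right)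
  then show ?thesis using assms(2) by (metis dvd_add dvd_mult dvd_mult2 dvd_triv_right)
qed

lemma comaximal_dvd_left:
  assumes "comaximal p q" "p' dvd p"
  shows "comaximal p' q"
  using assms unfolding comaximal_def dvd_def by (metis mult.assoc mult.commute)

lemma comaximal_dvd_right:
  assumes "comaximal p q" "q' dvd q"
  shows "comaximal p q'"
  using comaximal_dvd_left comaximal_sym assms by metis

lemma comaximal_mult_left:
  assumes "comaximal p q" "comaximal p' q"
  shows "comaximal (p * p') q"
proof -
  obtain s t s' t' where e: "s * p + t * q = 1" "s' * p' + t' * q = 1"
    using assms by (auto simp: comaximal_def)
  have "(s * s') * (p * p') + (s * p * t' + t * (s' * p') + t * q * t') * q
      = (s * p + t * q) * (s' * p' + t' * q)" by (simp add: algebra_simps)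
  then show ?thesis using e unfolding comaximal_def by (metis mult_1)
qed

text \<open>Euclid's algorithm again, now carrying the multipliers along. It produces some gcd that is
a combination of the arguments; uniqueness of the monic gcd identifies it with the chosen one.\<close>

lemma poly_gcd_bezout:
  obtains s t where "poly_gcd p q = s * p + t * q"
proof -
  have "\<exists>h s t. is_poly_gcd p q h \<and> h = s * p + t * q"
  proof (induction "if q = 0 then 0 else Suc (degree q)" arbitrary: p q rule: less_induct)
    case less
    show ?case
    proof (cases "q = 0")
      case True
      have "is_poly_gcd p q ([:inverse (lead_coeff p):] * p)"
        using True by (auto simp: is_poly_gcd_def smult_dvd_iff dvd_smult_iff)
      moreover have "[:inverse (lead_coeff p):] * p = [:inverse (lead_coeff p):] * p + 0 * q"
        by simp
      ultimately show ?thesis by blast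
    next
      case False
      have "(if p mod q = 0 then 0 else Suc (degree (p mod q))) < Suc (degree q)"
        using degree_mod_less[OF False, of p] by auto
      then obtain h s t where h: "is_poly_gcd q (p mod q) h" "h = s * q + t * (p mod q)"
        using less[of "p mod q" q] False by auto
      moreover have "k dvd q \<and> k dvd p mod q \<longleftrightarrow> k dvd p \<and> k dvd q" for k
        by (metis dvd_mod_iff)
      ultimately have "is_poly_gcd p q h"
        unfolding is_poly_gcd_def by metis
      moreover have "h = t * p + (s - t * (p div q)) * q"
        by (simp add: h(2) minus_div_mult_eq_mod[symmetric] algebra_simps)
      ultimately show ?thesis by blast
    qed
  qed
  then show ?thesis using that is_poly_gcd_unique is_poly_gcd_poly_gcd by metis
qed

lemma poly_gcd_dvd: "poly_gcd p q dvd p" "poly_gcd p q dvd q"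
  and poly_gcd_greatest: "k dvd p \<Longrightarrow> k dvd q \<Longrightarrow> k dvd poly_gcd p q"
  using is_poly_gcd_poly_gcd[of p q] by (auto simp: is_poly_gcd_def)

text \<open>Multiplying by \<open>g\<close> modulo \<open>P\<close> kills exactly the multiples of \<open>P / gcd g P\<close>. For one
direction, a Bezout representation of the gcd turns \<open>P dvd f * g\<close> into \<open>P dvd f * gcd g P\<close>,
where the gcd can be cancelled. With \<open>P = X\<^sup>n - 1\<close> this gives the annihilator of \<open>g\<close> in
\<open>F[X]/(X\<^sup>n - 1)\<close>.\<close>

lemma dvd_mult_iff_cofactor_dvd:
  assumes "P \<noteq> 0" "P = poly_gcd g P * h"
  shows "P dvd f * g \<longleftrightarrow> h dvd f"
proof
  define a where "a = poly_gcd g P"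
  have a: "P = a * h" "a \<noteq> 0" using assms by (auto simp: a_def)
  {
    assume "P dvd f * g"
    obtain s t where "a = s * g + t * P" unfolding a_def by (rule poly_gcd_bezout)
    then have "a * f = s * (f * g) + t * f * P" by (simp add: algebra_simps)
    then have "P dvd a * f" using \<open>P dvd f * g\<close> by (metis dvd_add dvd_mult dvd_triv_right)
    then show "h dvd f" using a by simp
  }
  assume "h dvd f"
  then have "h * a dvd f * g" by (intro mult_dvd_mono) (simp_all add: a_def poly_gcd_dvd)
  then show "P dvd f * g" using a by (simp add: mult.commute)
qed

text \<open>Two annihilation conditions amount to divisibility by the least common multiple, here in
the form \<open>h1 * x\<close> with \<open>x = h2 / gcd h1 h2\<close>, from which its degree can be read off.\<close>

lemma poly_gcd_lcm:
  assumes "h1 \<noteq> 0"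
  obtains x where "h2 = poly_gcd h1 h2 * x" "\<And>f. h1 dvd f \<and> h2 dvd f \<longleftrightarrow> h1 * x dvd f"
proof -
  define c where "c = poly_gcd h1 h2"
  obtain x y where x: "h2 = c * x" and y: "h1 = c * y"
    unfolding c_def using poly_gcd_dvd by (metis dvdE)
  have "h1 dvd f \<and> h2 dvd f \<longleftrightarrow> h1 * x dvd f" for f
  proof
    assume f: "h1 dvd f \<and> h2 dvd f"
    obtain s t where "c = s * h1 + t * h2" unfolding c_def by (rule poly_gcd_bezout)
    then have "c * f = s * (h1 * f) + t * (f * h2)" by (simp add: algebra_simps)
    moreover have "h1 * h2 dvd h1 * f" "h1 * h2 dvd f * h2"
      using f by (auto intro: mult_dvd_mono)
    ultimately have "h1 * h2 dvd c * f" by (simp add: dvd_mult)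
    then have "c * (h1 * x) dvd c * f" by (simp add: x mult.left_commute)
    then show "h1 * x dvd f" using assms y by auto
  next
    assume "h1 * x dvd f"
    moreover have "h1 * x = h2 * y" by (simp add: x y mult.commute mult.left_commute)
    ultimately show "h1 dvd f \<and> h2 dvd f" by (metis dvd_mult_left)
  qed
  then show ?thesis using that x unfolding c_def by blast
qed

section \<open>The polynomials \<open>X\<^sup>n - 1\<close>\<close>

abbreviation (input) cyclic_poly :: "nat \<Rightarrow> 'a::field poly" where
  "cyclic_poly n \<equiv> monom 1 n - 1"

lemma degree_cyclic_poly: "n > 0 \<Longrightarrow> degree (cyclic_poly n :: 'a::field poly) = n"
  by (metis degree_1 degree_add_eq_left degree_minus degree_monom_eq diff_conv_add_uminus zero_neq_one)

lemma cyclic_poly_nonzero: "n > 0 \<Longrightarrow> (cyclic_poly n :: 'a::field poly) \<noteq> 0"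
  by (metis degree_cyclic_poly degree_0 less_numeral_extra(3))

lemma cyclic_poly_dvd_mult: "(cyclic_poly n :: 'a::field poly) dvd cyclic_poly (n * k)"
proof (induction k)
  case (Suc k)
  have "cyclic_poly (n * Suc k) = monom 1 (n * k) * cyclic_poly n + (cyclic_poly (n * k) :: 'a poly)"
    by (simp add: algebra_simps mult_monom)
  then show ?case using Suc by (metis dvd_add dvd_triv_right)
qed (simp add: monom_0 one_pCons)

text \<open>The nontrivial half of \<open>gcd (X\<^sup>n - 1) (X^n' - 1) = X\<^sup>l - 1\<close> with \<open>l = gcd n n'\<close>. From
\<open>n x = n' y + l\<close> one gets \<open>X\<^sup>l - 1\<close> as \<open>X^(n x) - 1\<close> minus \<open>X\<^sup>l (X^(n' y) - 1)\<close>,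
and a common divisor divides both terms.\<close>

lemma dvd_cyclic_poly_gcd:
  fixes k :: "'a::field poly"
  assumes "n > 0" "k dvd cyclic_poly n" "k dvd cyclic_poly n'"
  shows "k dvd cyclic_poly (gcd n n')"
proof -
  obtain x y where xy: "n * x = n' * y + gcd n n'" using bezout_nat[of n n'] assms(1) by auto
  have 1: "k dvd cyclic_poly (n * x)" "k dvd cyclic_poly (n' * y)"
    using assms cyclic_poly_dvd_mult dvd_trans by blast+
  have "cyclic_poly (gcd n n') = (cyclic_poly (n * x) :: 'a poly)
      - monom 1 (gcd n n') * cyclic_poly (n' * y)"
    unfolding xy by (simp add: algebra_simps mult_monom)
  then show ?thesis using 1 by (metis dvd_diff dvd_mult)
qed

text \<open>This is where the hypothesis on the characteristic enters: \<open>X\<^sup>n - 1\<close> is separable, since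
\<open>(X / n) (X\<^sup>n - 1)' - (X\<^sup>n - 1) = 1\<close>. Expanding the derivative of a product \<open>a * b\<close> in this
identity exhibits Bezout multipliers for \<open>a\<close> and \<open>b\<close>.\<close>

lemma comaximal_factors_cyclic_poly:
  fixes a b :: "'a::field poly"
  assumes "of_nat n \<noteq> (0 :: 'a)" "a * b = cyclic_poly n"
  shows "comaximal a b"
proof -
  have n: "n > 0" using assms(1) by (cases n) auto
  define c where "c = [:inverse (of_nat n) :: 'a:]"
  have "pderiv (cyclic_poly n) = monom (of_nat n :: 'a) (n - 1)"
    by (simp add: pderiv_diff pderiv_monom pderiv_1)
  then have "c * monom 1 1 * pderiv (cyclic_poly n) = monom (1 :: 'a) n"
    using assms(1) n by (simp add: c_def mult_monom smult_monom)
  then have "1 = c * monom 1 1 * pderiv (a * b) - a * b" using assms(2) by simp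
  also have "\<dots> = (c * monom 1 1 * pderiv b - b) * a + (c * monom 1 1 * pderiv a) * b"
    unfolding pderiv_mult by (simp add: algebra_simps)
  finally show ?thesis unfolding comaximal_def by metis
qed

section \<open>The annihilator of a pair of generators\<close>

text \<open>As \<open>X\<^sup>n - 1\<close> is squarefree, an irreducible factor of it that divides \<open>g\<close> is used up by
the gcd and cannot occur in \<open>h\<close> again.\<close>

lemma comaximal_cofactor:
  assumes "of_nat n \<noteq> (0 :: 'a::field)" "cyclic_poly n = poly_gcd g (cyclic_poly n) * (h :: 'a poly)"
  shows "comaximal g h"
proof -
  define P a where "P = (cyclic_poly n :: 'a poly)" and "a = poly_gcd g P"
  have Ph: "P = a * h" using assms(2) by (simp add: P_def a_def)
  have "comaximal a h" using comaximal_factors_cyclic_poly[of n a h] assms(1) Ph by (simp add: P_def)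
  then obtain s t where st: "s * a + t * h = 1" by (auto simp: comaximal_def)
  obtain u v where uv: "a = u * g + v * P" unfolding a_def by (rule poly_gcd_bezout)
  have "(s * u) * g + (s * v * a + t) * h = s * (u * g + v * P) + t * h"
    unfolding Ph by (simp add: algebra_simps)
  then have "(s * u) * g + (s * v * a + t) * h = 1" using st unfolding uv[symmetric] by simp
  then show ?thesis unfolding comaximal_def by blast
qed

text \<open>Up to units, \<open>gcd h1 h2\<close> and \<open>w\<close> are both the product of the irreducible factors of \<open>X\<^sup>l - 1\<close> (with
\<open>l = gcd n n'\<close>) that divide neither \<open>g\<close> nor \<open>g'\<close>. Without factorisations, this
amounts to mutual divisibility: \<open>gcd h1 h2\<close> divides \<open>X\<^sup>l - 1\<close> and is comaximal to
\<open>gcd (g g') (X\<^sup>l - 1)\<close>, so it divides the cofactor \<open>w\<close>; conversely \<open>w\<close> divides \<open>X\<^sup>n - 1\<close> and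
is comaximal to \<open>gcd g (X\<^sup>n - 1)\<close>, so it divides \<open>h1\<close>, and likewise \<open>h2\<close>.\<close>

lemma degree_gcd_cofactors:
  fixes g g' h1 h2 w :: "'a::field poly"
  assumes n: "of_nat n \<noteq> (0 :: 'a)" "of_nat n' \<noteq> (0 :: 'a)"
    and h1: "cyclic_poly n = poly_gcd g (cyclic_poly n) * h1"
    and h2: "cyclic_poly n' = poly_gcd g' (cyclic_poly n') * h2"
    and w: "cyclic_poly (gcd n n') = poly_gcd (g * g') (cyclic_poly (gcd n n')) * w"
  shows "degree (poly_gcd h1 h2) = degree w"
proof -
  define c e where "c = poly_gcd h1 h2" and "e = poly_gcd (g * g') (cyclic_poly (gcd n n'))"
  have pos: "n > 0" "n' > 0" using n by (auto intro: Nat.gr0I)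
  have l: "of_nat (gcd n n') \<noteq> (0 :: 'a)"
    using n(1) by (metis gcd_dvd1 dvdE mult_zero_left of_nat_mult)
  have c: "c dvd h1" "c dvd h2" by (simp_all add: c_def poly_gcd_dvd)
  have "c dvd cyclic_poly n" "c dvd cyclic_poly n'" using c h1 h2 by (metis dvd_mult)+
  then have "c dvd cyclic_poly (gcd n n')" using pos dvd_cyclic_poly_gcd by blast
  then have "c dvd e * w" using w by (simp add: e_def)
  moreover have "comaximal c e"
  proof -
    have "comaximal g c" "comaximal g' c"
      using comaximal_dvd_right[OF comaximal_cofactor[OF n(1) h1] c(1)]
        comaximal_dvd_right[OF comaximal_cofactor[OF n(2) h2] c(2)] by auto
    then have "comaximal (g * g') c" by (rule comaximal_mult_left)
    then have "comaximal e c" by (rule comaximal_dvd_left) (simp add: e_def poly_gcd_dvd)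
    then show ?thesis by (rule comaximal_sym)
  qed
  ultimately have "c dvd w" by (rule comaximal_dvd_mult[rotated])
  moreover have "w dvd c"
  proof -
    have gw: "comaximal (g * g') w" by (rule comaximal_cofactor[OF l w])
    have wl: "w dvd cyclic_poly (gcd n n')" using w by (metis dvd_triv_right)
    have "w dvd cyclic_poly n" "w dvd cyclic_poly n'"
      using dvd_trans[OF wl] cyclic_poly_dvd_mult by (metis dvdE gcd_dvd1, metis dvdE gcd_dvd2)
    then have "w dvd poly_gcd g (cyclic_poly n) * h1" "w dvd poly_gcd g' (cyclic_poly n') * h2"
      using h1 h2 by simp_all
    moreover have "poly_gcd g (cyclic_poly n) dvd g * g'" "poly_gcd g' (cyclic_poly n') dvd g * g'"
      using poly_gcd_dvd(1) by (metis dvd_mult dvd_mult2)+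
    then have "comaximal w (poly_gcd g (cyclic_poly n))" "comaximal w (poly_gcd g' (cyclic_poly n'))"
      using comaximal_dvd_left[OF gw] comaximal_sym by blast+
    ultimately have "w dvd h1" "w dvd h2" using comaximal_dvd_mult by blast+
    then show ?thesis unfolding c_def by (rule poly_gcd_greatest)
  qed
  moreover have "w \<noteq> 0" using w cyclic_poly_nonzero[of "gcd n n'", where 'a='a] pos by auto
  ultimately show ?thesis
    unfolding c_def by (metis dvd_0_left dvd_imp_degree_le le_antisym)
qed

text \<open>The annihilator of \<open>(g, g')\<close> in \<open>F[X]\<close> is generated by the least common multiple \<open>L\<close> of the
two cofactors \<open>h1 = (X\<^sup>n - 1) / gcd g (X\<^sup>n - 1)\<close> and \<open>h2\<close> (likewise for \<open>g'\<close>). Its degree is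
\<open>deg h1 + deg h2 - deg (gcd h1 h2)\<close>. That \<open>L\<close> divides \<open>X^(lcm n n') - 1\<close> bounds its degree by
the number of rows of the double circulant matrix.\<close>

lemma annihilator_polynomial:
  fixes g g' :: "'a::field poly"
  assumes n: "of_nat n \<noteq> (0 :: 'a)" "of_nat n' \<noteq> (0 :: 'a)"
  defines "d \<equiv> degree ((poly_gcd g (cyclic_poly n) * poly_gcd g' (cyclic_poly n') * cyclic_poly (gcd n n'))
                      div poly_gcd (g * g') (cyclic_poly (gcd n n')))"
  obtains L where "L \<noteq> 0" "degree L + d = n + n'" "L dvd cyclic_poly (lcm n n')"
    "\<And>f. cyclic_poly n dvd f * g \<and> cyclic_poly n' dvd f * g' \<longleftrightarrow> L dvd f"
proof -
  have pos: "n > 0" "n' > 0" using n by (auto intro: Nat.gr0I)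
  define P P' Q where P: "P = (cyclic_poly n :: 'a poly)" and P': "P' = (cyclic_poly n' :: 'a poly)"
    and Q: "Q = (cyclic_poly (gcd n n') :: 'a poly)"
  have nz: "P \<noteq> 0" "P' \<noteq> 0" "Q \<noteq> 0" unfolding P P' Q
    by (rule cyclic_poly_nonzero[OF pos(1)], rule cyclic_poly_nonzero[OF pos(2)],
        rule cyclic_poly_nonzero, use pos in simp)
  obtain h1 where h1: "P = poly_gcd g P * h1" using poly_gcd_dvd(2) by (rule dvdE)
  obtain h2 where h2: "P' = poly_gcd g' P' * h2" using poly_gcd_dvd(2) by (rule dvdE)
  obtain w where w: "Q = poly_gcd (g * g') Q * w" using poly_gcd_dvd(2) by (rule dvdE)
  have "poly_gcd g P * h1 \<noteq> 0" "poly_gcd g' P' * h2 \<noteq> 0" "poly_gcd (g * g') Q * w \<noteq> 0"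
    using nz h1 h2 w by argo+
  then have nz2: "h1 \<noteq> 0" "h2 \<noteq> 0" "w \<noteq> 0" "poly_gcd g P \<noteq> 0" "poly_gcd g' P' \<noteq> 0"
      "poly_gcd (g * g') Q \<noteq> 0"
    by auto
  obtain x where x: "h2 = poly_gcd h1 h2 * x"
    and lcm: "\<And>f. h1 dvd f \<and> h2 dvd f \<longleftrightarrow> h1 * x dvd f" using poly_gcd_lcm[OF nz2(1)] by blast
  have iff: "P dvd f * g \<and> P' dvd f * g' \<longleftrightarrow> h1 * x dvd f" for f
    using dvd_mult_iff_cofactor_dvd[OF nz(1) h1] dvd_mult_iff_cofactor_dvd[OF nz(2) h2] lcm by blast
  have nz3: "x \<noteq> 0" "poly_gcd h1 h2 \<noteq> 0" using x nz2 by auto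
  have degc: "degree (poly_gcd h1 h2) = degree w"
    using degree_gcd_cofactors[OF n h1[unfolded P] h2[unfolded P'] w[unfolded Q]] .
  define e where "e = poly_gcd (g * g') Q"
  have Q_eq: "Q = w * e" and "e \<noteq> 0" using w nz2 by (simp_all add: e_def mult.commute)
  have "poly_gcd g P * poly_gcd g' P' * Q div e = poly_gcd g P * poly_gcd g' P' * w"
    unfolding Q_eq mult.assoc[symmetric] using \<open>e \<noteq> 0\<close> by simp
  then have "d = degree (poly_gcd g P * poly_gcd g' P' * w)"
    unfolding d_def P[symmetric] P'[symmetric] Q[symmetric] e_def[symmetric] by simp
  then have d: "d = degree (poly_gcd g P) + degree (poly_gcd g' P') + degree w"
    using nz2 by (simp add: degree_mult_eq)
  have "n = degree (poly_gcd g P) + degree h1" "n' = degree (poly_gcd g' P') + degree h2"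
    using arg_cong[OF h1, of degree] arg_cong[OF h2, of degree] nz2 pos
    by (simp_all add: degree_mult_eq P P' degree_cyclic_poly)
  moreover have "degree h2 = degree w + degree x"
    using arg_cong[OF x, of degree] nz3 by (simp add: degree_mult_eq degc)
  ultimately have "degree (h1 * x) + d = n + n'" using d nz2 nz3 by (simp add: degree_mult_eq)
  moreover have "h1 * x dvd cyclic_poly (lcm n n')"
  proof -
    have "P dvd cyclic_poly (lcm n n')" "P' dvd cyclic_poly (lcm n n')" unfolding P P'
      by (metis cyclic_poly_dvd_mult dvdE dvd_lcm1, metis cyclic_poly_dvd_mult dvdE dvd_lcm2)
    then show ?thesis unfolding iff[symmetric] by simp
  qed
  ultimately show ?thesis using that[of "h1 * x"] nz2 nz3 iff by (simp add: P P')
qed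

section \<open>Multiplication by powers of \<open>X\<close> modulo \<open>X\<^sup>n - 1\<close>\<close>

text \<open>Multiplication by \<open>X\<close> modulo \<open>X\<^sup>n - 1\<close> is the circular right shift: subtracting
\<open>q_(n-1) (X\<^sup>n - 1)\<close> from \<open>X q\<close> removes the leading term and puts its coefficient at position 0.\<close>

lemma coeff_pCons_0_mod_cyclic_poly:
  fixes q :: "'a::field poly"
  assumes "degree q < n" "j < n"
  shows "coeff (pCons 0 q mod cyclic_poly n) j = coeff q (nat ((int j - 1) mod int n))"
proof -
  define P where "P = (cyclic_poly n :: 'a poly)"
  \<comment> \<open>The remainder, written down explicitly.\<close>
  define u where "u = pCons 0 q - Polynomial.smult (coeff q (n - 1)) P"
  have cP: "coeff P k = (if k = n then 1 else 0) - (if k = 0 then 1 else 0)" for k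
    by (simp add: P_def coeff_1)
  have cu: "coeff u k = 0" if "k \<ge> n" for k
    using that assms by (auto simp: u_def cP coeff_pCons coeff_eq_0 split: nat.split)
  have "degree P = n" using assms(2) by (simp add: P_def degree_cyclic_poly)
  moreover have "degree u < n"
    using cu assms(2) by (metis leading_coeff_0_iff degree_0 leI gr0I not_less0)
  ultimately have "u mod P = u" by (simp add: mod_poly_less)
  moreover have "pCons 0 q = u + Polynomial.smult (coeff q (n - 1)) P" by (simp add: u_def)
  ultimately have "pCons 0 q mod P = u"
    by (simp add: poly_mod_add_left mod_smult_left)
  moreover have "coeff u j = coeff q (nat ((int j - 1) mod int n))"
  proof (cases j)
    case 0
    have "(- 1) mod int n = int n - 1" using assms(2) by (simp add: zmod_minus1)
    then have "nat ((- 1) mod int n) = n - 1" by simp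
    then show ?thesis using 0 assms(2) by (simp add: u_def cP)
  next
    case (Suc k)
    then show ?thesis using assms(2) by (simp add: u_def cP)
  qed
  ultimately show ?thesis by (simp add: P_def)
qed

lemma coeff_monom_mult_mod_cyclic_poly:
  fixes g :: "'a::field poly"
  assumes "degree g < n" "j < n"
  shows "coeff (monom 1 i * g mod cyclic_poly n) j = coeff g (nat ((int j - int i) mod int n))"
  using assms(2)
proof (induction i arbitrary: j)
  case 0
  have "degree (cyclic_poly n :: 'a poly) = n" using assms by (intro degree_cyclic_poly) simp
  then show ?case using 0 assms(1) by (simp add: mod_poly_less monom_0)
next
  case (Suc i)
  define P where "P = (cyclic_poly n :: 'a poly)"
  define q where "q = monom 1 i * g mod P"
  have dP: "degree P = n" unfolding P_def using assms by (intro degree_cyclic_poly) simp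
  then have dq: "degree q < n" unfolding q_def using assms
    by (metis degree_mod_less degree_0 not_less0 gr0I)
  have "monom 1 (Suc i) * g mod P = [:0, 1:] * (monom 1 i * g) mod P"
    by (simp add: monom_Suc)
  also have "\<dots> = [:0, 1:] * q mod P" unfolding q_def by (simp only: mod_mult_right_eq)
  also have "[:0, 1:] * q = pCons 0 q" by simp
  finally have "coeff (monom 1 (Suc i) * g mod P) j = coeff q (nat ((int j - 1) mod int n))"
    using coeff_pCons_0_mod_cyclic_poly[OF dq Suc.prems] by (simp add: P_def)
  also have "\<dots> = coeff g (nat (((int j - 1) mod int n - int i) mod int n))"
    using Suc.IH[of "nat ((int j - 1) mod int n)"] Suc.prems by (simp add: q_def P_def nat_less_iff)
  also have "((int j - 1) mod int n - int i) mod int n = (int j - int (Suc i)) mod int n"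
    by (simp add: mod_diff_left_eq algebra_simps)
  finally show ?case by (simp add: P_def)
qed

section \<open>Bases of cyclic modules over \<open>F[X]\<close>\<close>

text \<open>A linear map \<open>\<phi>\<close> from \<open>F[X]\<close> with kernel \<open>(L)\<close> identifies its range with \<open>F[X]/(L)\<close>, in
which every class has a unique representative of degree below \<open>deg L\<close>. Existence of the
representative (the remainder modulo \<open>L\<close>) gives generation, uniqueness gives independence.\<close>

lemma basis_of_cyclic_module:
  fixes \<phi> :: "'a::field poly \<Rightarrow> 'a vec"
  assumes carrier: "\<And>f. \<phi> f \<in> carrier_vec N"
    and add: "\<And>f h. \<phi> (f + h) = \<phi> f + \<phi> h"
    and smult: "\<And>c f. \<phi> (Polynomial.smult c f) = c \<cdot>\<^sub>v \<phi> f"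
    and kernel: "\<And>f. \<phi> f = 0\<^sub>v N \<longleftrightarrow> L dvd f"
    and "L \<noteq> 0"
  defines "rs \<equiv> map (\<lambda>i. \<phi> (monom 1 i)) [0..<degree L]"
  shows "VectorSpace.subspace class_ring (range \<phi>) (module_vec TYPE('a) N)"
    and "distinct rs"
    and "vectorspace.basis class_ring (code_space N (range \<phi>)) (set rs)"
    and "code_dim N (range \<phi>) = degree L"
proof -
  interpret V: vec_space "TYPE('a)" N .
  define b where "b = (\<lambda>i. \<phi> (monom 1 i))"
  define B where "B = b ` {..<degree L}"
  have \<phi>0: "\<phi> 0 = 0\<^sub>v N" using kernel[of 0] by simp
  have \<phi>_diff: "\<phi> f = \<phi> h \<longleftrightarrow> L dvd f - h" for f h
  proof -
    have "\<phi> f = \<phi> (f - h) + \<phi> h" using add[of "f - h" h] by simp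
    moreover have "\<phi> (f - h) + \<phi> h = \<phi> h \<longleftrightarrow> \<phi> (f - h) = 0\<^sub>v N"
      using carrier by auto
    ultimately show ?thesis using kernel by simp
  qed
  have \<phi>_sum: "\<phi> (sum p I) $ k = (\<Sum>i\<in>I. \<phi> (p i) $ k)" if "k < N" for p k and I :: "nat set"
  proof (induction I rule: infinite_finite_induct)
    case (insert i I)
    then show ?case using that carrier_vecD[OF carrier] by (simp add: add)
  qed (use that \<phi>0 in auto)
  have small: "f = 0" if "L dvd f" "f = 0 \<or> degree f < degree L" for f
    using that dvd_imp_degree_le[of L f] by fastforce
  show sub: "VectorSpace.subspace class_ring (range \<phi>) (module_vec TYPE('a) N)"
  proof (rule subspace.intro[OF vec_vs], unfold_locales, goal_cases)
    case (2 v w)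
    then show ?case by (auto simp: module_vec_simps simp flip: add)
  next
    case 3
    show ?case using \<phi>0[symmetric] by (simp add: module_vec_simps)
  next
    case (4 c v)
    then show ?case by (auto simp: module_vec_simps simp flip: smult)
  qed (use carrier in \<open>auto simp: module_vec_simps\<close>)
  have inj: "inj_on b {..<degree L}"
  proof (rule inj_onI)
    fix i j assume ij: "i \<in> {..<degree L}" "j \<in> {..<degree L}" "b i = b j"
    have "monom (1 :: 'a) i - monom 1 j = 0"
    proof (rule small)
      show "L dvd monom 1 i - monom 1 j" using ij \<phi>_diff by (simp add: b_def)
      show "monom (1 :: 'a) i - monom 1 j = 0 \<or> degree (monom (1 :: 'a) i - monom 1 j) < degree L"
        using ij by (intro disjI2 degree_diff_less) (simp_all add: degree_monom_eq)
    qed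
    then show "i = j" by (simp add: monom_eq_iff')
  qed
  then show "distinct rs" by (simp add: rs_def b_def distinct_map atLeast0LessThan)
  have set_rs: "set rs = B" by (simp add: rs_def B_def b_def atLeast0LessThan)
  have B: "finite B" "B \<subseteq> range \<phi>" "B \<subseteq> carrier_vec N"
    using carrier by (auto simp: B_def b_def)
  \<comment> \<open>Linear combinations of the candidate basis are the images of polynomials of low degree.\<close>
  have lincomb: "V.lincomb a B = \<phi> (\<Sum>i<degree L. monom (a (b i)) i)" for a
  proof (rule eq_vecI)
    fix k assume "k < dim_vec (\<phi> (\<Sum>i<degree L. monom (a (b i)) i))"
    then have k: "k < N" using carrier_vecD[OF carrier] by simp
    have "V.lincomb a B $ k = (\<Sum>v\<in>B. a v * v $ k)"
      by (rule V.lincomb_index[OF k B(3)])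
    also have "\<dots> = (\<Sum>i<degree L. a (b i) * b i $ k)"
      unfolding B_def by (simp add: sum.reindex[OF inj])
    also have "\<dots> = (\<Sum>i<degree L. \<phi> (monom (a (b i)) i) $ k)"
    proof (rule sum.cong[OF refl])
      fix i
      have "\<phi> (monom (a (b i)) i) = a (b i) \<cdot>\<^sub>v b i"
        unfolding b_def by (simp flip: smult add: smult_monom)
      then show "a (b i) * b i $ k = \<phi> (monom (a (b i)) i) $ k"
        using k carrier_vecD[OF carrier] by (simp add: b_def)
    qed
    finally show "V.lincomb a B $ k = \<phi> (\<Sum>i<degree L. monom (a (b i)) i) $ k"
      using \<phi>_sum[OF k] by simp
  qed (use B carrier_vecD[OF carrier] in simp)
  have li: "\<not> V.lin_dep B"
  proof (rule V.finite_lin_indpt2[OF B(1)])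
    fix a assume "V.lincomb a B = 0\<^sub>v N"
    then have "L dvd (\<Sum>i<degree L. monom (a (b i)) i)" using lincomb kernel by simp
    moreover have "(\<Sum>i<degree L. monom (a (b i)) i) = 0 \<or> degree (\<Sum>i<degree L. monom (a (b i)) i) < degree L"
    proof (cases "degree L = 0")
      case False
      then show ?thesis
        by (intro disjI2 degree_sum_less) (auto intro: le_less_trans[OF degree_monom_le])
    qed simp
    ultimately have "(\<Sum>i<degree L. monom (a (b i)) i) = 0" by (rule small)
    then have "coeff (\<Sum>i<degree L. monom (a (b i)) i) j = 0" for j by simp
    moreover have "coeff (\<Sum>i<degree L. monom (a (b i)) i) j = a (b j)" if "j < degree L" for j
      using that by (simp add: coeff_sum)
    ultimately show "\<forall>v\<in>B. a v = 0" by (auto simp: B_def)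
  qed (use B in simp)
  have span: "V.span B = range \<phi>"
  proof
    show "V.span B \<subseteq> range \<phi>" using lincomb V.finite_span[OF B(1,3)] by auto
    show "range \<phi> \<subseteq> V.span B"
    proof clarify
      fix f
      define q where "q = f mod L"
      have "degree q < degree L \<or> q = 0" unfolding q_def using \<open>L \<noteq> 0\<close> degree_mod_less by blast
      then have "q = (\<Sum>i<degree L. monom (coeff q i) i)"
        by (intro poly_eqI) (auto simp: coeff_sum coeff_eq_0)
      \<comment> \<open>Coefficients have to be indexed by basis vectors, so the index \<open>i\<close> is recovered from \<open>b i\<close>.\<close>
      moreover have "coeff q (inv_into {..<degree L} b (b i)) = coeff q i" if "i < degree L" for i
        using inj that by simp
      ultimately have "q = (\<Sum>i<degree L. monom (coeff q (inv_into {..<degree L} b (b i))) i)"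
        by simp
      then have "\<phi> q = V.lincomb (\<lambda>v. coeff q (inv_into {..<degree L} b v)) B" unfolding lincomb by simp
      moreover have "\<phi> f = \<phi> q" by (simp add: \<phi>_diff q_def minus_mod_eq_mult_div)
      ultimately show "\<phi> f \<in> V.span B" using V.finite_span[OF B(1,3)] by auto
    qed
  qed
  have subm: "submodule class_ring (range \<phi>) (module_vec TYPE('a) N)"
    using sub by (simp add: subspace_def)
  interpret W: vectorspace class_ring "code_space N (range \<phi>)"
    using V.subspace_is_vs[OF sub] .
  have basis: "W.basis B"
  proof -
    have "W.span B = range \<phi>" using V.span_li_not_depend(1)[OF B(2) subm] span by (rule trans)
    moreover have "W.lin_dep B = V.lin_dep B" using V.span_li_not_depend(2)[OF B(2) subm] .
    ultimately show ?thesis unfolding W.basis_def using li B(2) by simp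
  qed
  then show "W.basis (set rs)" by (simp add: set_rs)
  have "card B = degree L" by (simp add: B_def card_image[OF inj])
  then show "W.dim = degree L" using W.dim_basis[OF B(1) basis] by simp
qed

section \<open>Words and rows of the double circulant matrix\<close>

lemma poly_word_carrier: "poly_word n p \<in> carrier_vec n"
  by (simp add: poly_word_def)

lemma poly_word_add: "poly_word n (p + q) = poly_word n p + poly_word n q"
  by (rule eq_vecI) (simp_all add: poly_word_def)

lemma poly_word_smult: "poly_word n (Polynomial.smult c p) = c \<cdot>\<^sub>v poly_word n p"
  by (rule eq_vecI) (simp_all add: poly_word_def)

lemma poly_word_eq_0_iff:
  assumes "degree p < n"
  shows "poly_word n p = 0\<^sub>v n \<longleftrightarrow> p = 0"
proof
  assume "poly_word n p = 0\<^sub>v n"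
  then have "coeff p i = 0" if "i < n" for i
    using that by (metis index_vec index_zero_vec(1) poly_word_def)
  then have "coeff p i = 0" for i using assms by (cases "i < n") (auto simp: coeff_eq_0)
  then show "p = 0" by (simp add: poly_eq_iff)
qed (auto simp: poly_word_def)

lemma poly_word_mod_eq_0_iff:
  fixes p :: "'a::field poly"
  assumes "n > 0"
  shows "poly_word n (p mod cyclic_poly n) = 0\<^sub>v n \<longleftrightarrow> cyclic_poly n dvd p"
proof -
  have "degree (p mod cyclic_poly n) < n"
    using degree_mod_less[OF cyclic_poly_nonzero[OF assms], of p] degree_cyclic_poly[OF assms, where 'a='a] assms
    by auto
  then show ?thesis by (simp add: poly_word_eq_0_iff dvd_eq_mod_eq_0)
qed

lemma row_double_circulant_mat:
  fixes g g' :: "'a::field poly"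
  assumes "degree g < n" "degree g' < n'" "i < m"
  shows "row (double_circulant_mat m n n' g g') i =
    poly_word n (monom 1 i * g mod cyclic_poly n) @\<^sub>v poly_word n' (monom 1 i * g' mod cyclic_poly n')"
proof -
  have row: "row (circulant_mat m k p) i = poly_word k (monom 1 i * p mod cyclic_poly k)"
    if "degree p < k" for k and p :: "'a poly"
    using that assms(3)
    by (intro eq_vecI) (simp_all add: circulant_mat_def poly_word_def coeff_monom_mult_mod_cyclic_poly)
  have "row (double_circulant_mat m n n' g g') i = row (circulant_mat m n g) i @\<^sub>v row (circulant_mat m n' g') i"
    unfolding double_circulant_mat_def
    by (rule row_four_block_mat(1)[where ?nr1.0 = m and ?nc1.0 = n and ?nc2.0 = n' and ?nr2.0 = 0])
      (use assms(3) in \<open>simp_all add: circulant_mat_def\<close>)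
  then show ?thesis using row assms by simp
qed

lemma rows_first_rows:
  assumes "r \<le> dim_row A"
  shows "rows (first_rows r A) = map (row A) [0..<r]"
proof -
  have "take r (rows A) = map (row A) [0..<r]" using assms by (simp add: rows_def take_map)
  moreover have "set (map (row A) [0..<r]) \<subseteq> carrier_vec (dim_col A)" by auto
  ultimately show ?thesis unfolding first_rows_def by (metis rows_mat_of_rows)
qed

section \<open>Dimension and generator matrix of the double cyclic code\<close>

lemma of_nat_neq_0_if_coprime_CHAR:
  assumes "coprime CHAR('a::field) n"
  shows "of_nat n \<noteq> (0 :: 'a)"
proof
  assume "of_nat n = (0 :: 'a)"
  then have "CHAR('a) dvd n" by (simp add: of_nat_eq_0_iff_char_dvd)
  then have "CHAR('a) = 1" using coprime_common_divisor_nat[OF assms dvd_refl] by blast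
  then show False using of_nat_CHAR[where 'a='a] by simp
qed

theorem theorem4p3:
  fixes g g' :: "'a::{field, finite} poly"
    and n n' m l d r :: nat
  assumes "n > 0" and "n' > 0"
    and "coprime CHAR('a) n" and "coprime CHAR('a) n'"
    and "degree g < n" and "degree g' < n'"
    and "m = lcm n n'" and "l = gcd n n'"
    and "d = degree ((poly_gcd g (monom 1 n - 1) * poly_gcd g' (monom 1 n' - 1) * (monom 1 l - 1))
                      div poly_gcd (g * g') (monom 1 l - 1))"
    and "r = n + n' - d"
  shows "d \<le> n + n'
    \<and> code_dim (n + n') (double_cyclic_code n n' g g') = r
    \<and> generator_matrix (n + n') (double_cyclic_code n n' g g')
        (first_rows r (double_circulant_mat m n n' g g'))"
proof -
  have n0: "of_nat n \<noteq> (0 :: 'a)" "of_nat n' \<noteq> (0 :: 'a)"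
    using assms(3,4) of_nat_neq_0_if_coprime_CHAR by blast+
  obtain L where "L \<noteq> 0" and deg: "degree L + d = n + n'" and "L dvd cyclic_poly m"
    and ann: "\<And>f. cyclic_poly n dvd f * g \<and> cyclic_poly n' dvd f * g' \<longleftrightarrow> L dvd f"
    using annihilator_polynomial[OF n0, of g g'] unfolding assms(7-9) by blast
  have r: "degree L = r" using deg assms(10) by simp
  have "m > 0" using assms(1,2,7) by (simp add: lcm_pos_nat)
  then have "r \<le> m"
    using dvd_imp_degree_le[OF \<open>L dvd cyclic_poly m\<close> cyclic_poly_nonzero[OF \<open>m > 0\<close>]]
      degree_cyclic_poly[OF \<open>m > 0\<close>, where 'a='a] r by simp
  define \<phi> where "\<phi> = (\<lambda>f. poly_word n (f * g mod cyclic_poly n) @\<^sub>v poly_word n' (f * g' mod cyclic_poly n'))"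
  have carrier: "\<phi> f \<in> carrier_vec (n + n')" for f
    unfolding \<phi>_def by (intro append_carrier_vec poly_word_carrier)
  have add: "\<phi> (f + h) = \<phi> f + \<phi> h" for f h
    unfolding \<phi>_def distrib_right poly_mod_add_left poly_word_add
    by (rule append_vec_add[symmetric]) (rule poly_word_carrier)+
  have smult: "\<phi> (Polynomial.smult c f) = c \<cdot>\<^sub>v \<phi> f" for c f
    unfolding \<phi>_def mult_smult_left mod_smult_left poly_word_smult
    by (rule eq_vecI) (auto simp: poly_word_def)
  have kernel: "\<phi> f = 0\<^sub>v (n + n') \<longleftrightarrow> L dvd f" for f
  proof -
    have "0\<^sub>v (n + n') = 0\<^sub>v n @\<^sub>v (0\<^sub>v n' :: 'a vec)" by (rule eq_vecI) auto
    then have "\<phi> f = 0\<^sub>v (n + n') \<longleftrightarrow>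
        poly_word n (f * g mod cyclic_poly n) = 0\<^sub>v n \<and> poly_word n' (f * g' mod cyclic_poly n') = 0\<^sub>v n'"
      unfolding \<phi>_def by (simp add: append_vec_eq[OF poly_word_carrier zero_carrier_vec])
    then show ?thesis using assms(1,2) ann by (simp add: poly_word_mod_eq_0_iff)
  qed
  have code: "double_cyclic_code n n' g g' = range \<phi>"
    by (auto simp: double_cyclic_code_def \<phi>_def)
  let ?M = "double_circulant_mat m n n' g g'"
  have dim: "dim_row ?M = m" "dim_col ?M = n + n'"
    by (simp_all add: double_circulant_mat_def circulant_mat_def)
  have "rows (first_rows r ?M) = map (row ?M) [0..<r]"
    using \<open>r \<le> m\<close> dim by (simp add: rows_first_rows)
  also have "\<dots> = map (\<lambda>i. \<phi> (monom 1 i)) [0..<degree L]"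
    using \<open>r \<le> m\<close> assms(5,6) by (simp add: r \<phi>_def row_double_circulant_mat)
  finally have rows: "rows (first_rows r ?M) = map (\<lambda>i. \<phi> (monom 1 i)) [0..<degree L]" .
  note basis = basis_of_cyclic_module[OF carrier add smult kernel \<open>L \<noteq> 0\<close>]
  have "dim_col (first_rows r ?M) = n + n'" by (simp add: first_rows_def dim)
  then have "generator_matrix (n + n') (range \<phi>) (first_rows r ?M)"
    unfolding generator_matrix_def rows using basis by blast
  moreover have "code_dim (n + n') (range \<phi>) = r" using basis(4) by (simp only: r)
  moreover have "d \<le> n + n'" using deg by simp
  ultimately show ?thesis unfolding code by blast
qed

end
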